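(* For each odd $\ell\geq 3$, there is some $k_0$ such that whenever $k\geq k_0$ is odd, there is a sequence $(G_n)$ of $C_{\ell}$-free graphs, $G_n$ having $n$ vertices, which contain asymptotically more copies of $C_k$ than the balanced blow-up of $C_{\ell+2}$ on $n$ vertices; that is, there is $c>0$ such that for all sufficiently large $n$ the number of copies of $C_k$ in $G_n$ exceeds the number of copies of $C_k$ in the balanced blow-up of $C_{\ell+2}$ on $n$ vertices by at least $c n^k$.
   Context: $C_m$ denotes the cycle of length $m$. A balanced blow-up of a graph $F$ on $n$ vertices is obtained by replacing the vertices of $F$ by independent sets whose sizes sum to $n$ and differ by at most one from each other, and replacing each edge of $F$ by the complete bipartite graph between the corresponding independent sets. (All balanced blow-ups of $C_{\ell+2}$ on $n$ vertices contain asymptotically the same number, up to $o(n^k)$, of copies of $C_k$.) *)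

theory Defs
  imports Complex_Main "HOL-Library.FuncSet"
begin

type_synonym 'a ugraph = "'a set \<times> 'a set set"

abbreviation verts :: "'a ugraph \<Rightarrow> 'a set" where
  "verts G \<equiv> fst G"

abbreviation edges :: "'a ugraph \<Rightarrow> 'a set set" where
  "edges G \<equiv> snd G"

definition simple_graph :: "'a ugraph \<Rightarrow> bool" where
  "simple_graph G \<longleftrightarrow> finite (verts G) \<and> (\<forall>e\<in>edges G. e \<subseteq> verts G \<and> card e = 2)"

definition subgraph_of :: "'a ugraph \<Rightarrow> 'a ugraph \<Rightarrow> bool" where
  "subgraph_of H G \<longleftrightarrow> simple_graph H \<and> verts H \<subseteq> verts G \<and> edges H \<subseteq> edges G"

definition graph_iso :: "'a ugraph \<Rightarrow> 'b ugraph \<Rightarrow> bool" where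
  "graph_iso F H \<longleftrightarrow> (\<exists>f. bij_betw f (verts F) (verts H) \<and> (\<lambda>e. f ` e) ` edges F = edges H)"

text \<open>Copies are unlabelled and not necessarily induced.\<close>

definition copies :: "'a ugraph \<Rightarrow> 'b ugraph \<Rightarrow> 'b ugraph set" where
  "copies F G = {H. subgraph_of H G \<and> graph_iso F H}"

definition num_copies :: "'a ugraph \<Rightarrow> 'b ugraph \<Rightarrow> nat" where
  "num_copies F G = card (copies F G)"

definition graph_free :: "'a ugraph \<Rightarrow> 'b ugraph \<Rightarrow> bool" where
  "graph_free F G \<longleftrightarrow> copies F G = {}"

text \<open>Meaningful for \<open>m \<ge> 3\<close> only.\<close>

definition cycle :: "nat \<Rightarrow> nat ugraph" where
  "cycle m = ({..<m}, {{i, (i + 1) mod m} | i. i < m})"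

text \<open>The map \<open>p\<close> sends each vertex of \<open>B\<close> to the vertex of \<open>F\<close> whose independent set contains it.
  When \<open>F\<close> is a simple graph, \<open>p x = p y\<close> makes \<open>{p x, p y}\<close> a singleton, so that the
  fibres are indeed independent.\<close>

definition balanced_blowup :: "'a ugraph \<Rightarrow> 'b ugraph \<Rightarrow> bool" where
  "balanced_blowup F B \<longleftrightarrow> simple_graph B \<and>
    (\<exists>p. p \<in> verts B \<rightarrow> verts F \<and>
      edges B = {{x, y} | x y. x \<in> verts B \<and> y \<in> verts B \<and> {p x, p y} \<in> edges F} \<and>
      (\<forall>u\<in>verts F. \<forall>v\<in>verts F.
        card {x \<in> verts B. p x = u} \<le> card {x \<in> verts B. p x = v} + 1))"

lemma simple_graph_cycle:
  assumes "m \<ge> 3"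
  shows "simple_graph (cycle m)"
proof -
  have "i \<noteq> Suc i mod m" if "i < m" for i
    using assms that by (cases "Suc i = m") auto
  then show ?thesis
    using assms by (auto simp: simple_graph_def cycle_def card_2_iff)
qed

lemma balanced_blowup_cycle_exists:
  assumes "m \<ge> 3"
  shows "\<exists>B :: nat ugraph. card (verts B) = n \<and> balanced_blowup (cycle m) B"
proof -
  define E where "E = {{x, y} | x y. x < n \<and> y < n \<and> {x mod m, y mod m} \<in> edges (cycle m)}"
  define B :: "nat ugraph" where "B = ({..<n}, E)"
  have noloop: "{u} \<notin> edges (cycle m)" for u
    using simple_graph_cycle[OF assms] by (auto simp: simple_graph_def)
  have "simple_graph B"
    using noloop by (auto simp: simple_graph_def B_def E_def card_2_iff) (metis insert_absorb2)
  moreover have "card {x \<in> {..<n}. x mod m = u} \<le> card {x \<in> {..<n}. x mod m = v} + 1"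
    if "u < m" "v < m" for u v
  proof -
    let ?A = "{x \<in> {..<n}. x mod m = u}" and ?C = "{x \<in> {..<n}. x mod m = v}"
    have ge: "x \<ge> m" if "x \<in> ?A - {u}" for x
      using that by (cases "x < m") auto
    let ?f = "\<lambda>x. (x div m - 1) * m + v"
    have eq: "x = (x div m - 1) * m + m + u" if "x \<in> ?A - {u}" for x
    proof -
      have "x div m \<ge> 1"
        using ge[OF that] assms by (simp add: Suc_le_eq div_greater_zero_iff)
      then obtain q where q: "x div m = Suc q" by (cases "x div m") auto
      have "x = x div m * m + x mod m" by simp
      with q that show ?thesis by simp
    qed
    have "inj_on ?f (?A - {u})"
    proof (rule inj_onI)
      fix x y assume xy: "x \<in> ?A - {u}" "y \<in> ?A - {u}" and "?f x = ?f y"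
      then have "(x div m - 1) * m = (y div m - 1) * m" by linarith
      with eq[OF xy(1)] eq[OF xy(2)] show "x = y" by linarith
    qed
    moreover have "?f ` (?A - {u}) \<subseteq> ?C"
    proof
      fix z assume "z \<in> ?f ` (?A - {u})"
      then obtain x where x: "x \<in> ?A - {u}" "z = ?f x" by blast
      have "z < x" using eq[OF x(1)] x(2) \<open>v < m\<close> by linarith
      moreover have "z mod m = v" using x(2) \<open>v < m\<close> by simp
      ultimately show "z \<in> ?C" using x(1) by simp
    qed
    ultimately have "card (?A - {u}) \<le> card ?C"
      by (intro card_inj_on_le) auto
    moreover have "card ?A \<le> card (?A - {u}) + 1"
      by (simp add: card_Diff_singleton_if) linarith
    ultimately show ?thesis by linarith
  qed
  ultimately have "balanced_blowup (cycle m) B"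
    unfolding balanced_blowup_def using assms
    by (intro conjI exI[of _ "\<lambda>x. x mod m"]) (auto simp: B_def E_def cycle_def)
  then show ?thesis by (intro exI[of _ B]) (simp add: B_def)
qed

end

theory Submission
  imports Defs
begin

text \<open>\<open>G\<^sub>n\<close> is an unbalanced blow-up of \<open>C\<^bsub>l+2\<^esub>\<close>: two adjacent parts contain about \<open>9n/20\<close> vertices
  each, and the \<open>l\<close> other parts share the remaining \<open>n/10\<close>. The cycles that alternate between the
  two large parts and go once around \<open>C\<^bsub>l+2\<^esub>\<close> already number about \<open>a (9/20)\<^sup>k n\<^sup>k\<close>, where \<open>a > 0\<close>
  depends on \<open>l\<close> only. In the balanced blow-up all degrees are about \<open>2n/(l+2)\<close>, so it has at most
  about \<open>n (2n/(l+2))\<^bsup>k-1\<^esup>\<close> cycles, and \<open>2/(l+2) \<le> 2/5 < 9/20\<close>.\<close>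

section \<open>Counting functions whose entries are chosen one after another\<close>

text \<open>Here \<open>C i f\<close> holds the values allowed for entry \<open>i\<close> once the
  earlier ones are fixed, and \<open>cong\<close> says that it looks at nothing else. Hence
  overwriting entry \<open>n\<close> keeps the earlier constraints valid, and \<open>f\<close> has
  exactly \<open>card (C n f)\<close> extensions. Both the lower count of injective functions and
  the upper count of walks rest on this recursion.\<close>

lemma card_sequential_choices:
  fixes C :: "nat \<Rightarrow> (nat \<Rightarrow> 'a) \<Rightarrow> 'a set"
  assumes cong: "\<And>i f g. (\<And>j. j < i \<Longrightarrow> f j = g j) \<Longrightarrow> C i f = C i g"
    and fin: "\<And>i f. finite (C i f)"
  defines "X \<equiv> \<lambda>n. {f \<in> extensional {..<n}. \<forall>i<n. f i \<in> C i f}"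
  shows "card (X (Suc n)) = (\<Sum>f\<in>X n. card (C n f))"
proof -
  let ?h = "\<lambda>n (f, x). f(n := x)"
  have img: "X (Suc n) = ?h n ` Sigma (X n) (C n)" for n
  proof (intro equalityI subsetI)
    fix f assume f: "f \<in> X (Suc n)"
    have C: "C i (restrict f {..<n}) = C i f" if "i \<le> n" for i
      using that by (intro cong) auto
    have "restrict f {..<n} \<in> X n" "f n \<in> C n (restrict f {..<n})"
      using f C by (auto simp: X_def)
    moreover have "f = ?h n (restrict f {..<n}, f n)"
      using f by (auto simp: X_def extensional_def fun_eq_iff)
    ultimately show "f \<in> ?h n ` Sigma (X n) (C n)" by blast
  next
    fix g assume "g \<in> ?h n ` Sigma (X n) (C n)"
    then obtain f x where f: "f \<in> X n" "x \<in> C n f" "g = f(n := x)" by auto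
    have C: "C i g = C i f" if "i \<le> n" for i
      using that f(3) by (intro cong) auto
    show "g \<in> X (Suc n)"
      using f C by (auto simp: X_def extensional_def less_Suc_eq)
  qed
  have inj: "inj_on (?h n) (Sigma (X n) (C n))" for n
  proof (rule inj_onI, clarsimp)
    fix f x g y
    assume fg: "f \<in> X n" "g \<in> X n" and eq: "f(n := x) = g(n := y)"
    have "f i = g i" for i
      using fg fun_cong[OF eq, of i] by (cases "i = n") (auto simp: X_def extensional_def)
    then show "f = g \<and> x = y" using fun_cong[OF eq, of n] by auto
  qed
  have finX: "finite (X n)" for n
  proof (induction n)
    case 0 then show ?case by (simp add: X_def)
  next
    case (Suc n) then show ?case unfolding img by (intro finite_imageI finite_SigmaI fin)
  qed
  show "card (X (Suc n)) = (\<Sum>f\<in>X n. card (C n f))"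
    using finX fin by (simp add: img card_image[OF inj] card_SigmaI)
qed

text \<open>When entry \<open>i\<close> is chosen, at most \<open>i\<close> elements of
  \<open>A i\<close> are already taken. Subtraction on naturals truncates, so the bound stays true,
  though trivial, if some \<open>A i\<close> is too small.\<close>

lemma card_inj_PiE_ge:
  fixes A :: "nat \<Rightarrow> 'a set"
  assumes "\<And>i. finite (A i)"
  shows "(\<Prod>i<n. card (A i) - i) \<le> card {f \<in> PiE {..<n} A. inj_on f {..<n}}"
proof -
  define C where "C = (\<lambda>i f. A i - f ` {..<i})"
  define X where "X = (\<lambda>n. {f \<in> extensional {..<n}. \<forall>i<n. f i \<in> C i f})"
  have seq: "card (X (Suc n)) = (\<Sum>f\<in>X n. card (C n f))" for n
    unfolding X_def by (rule card_sequential_choices) (use assms in \<open>auto simp: C_def\<close>)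
  have "(\<Prod>i<n. card (A i) - i) \<le> card (X n)"
  proof (induction n)
    case 0 then show ?case by (simp add: X_def)
  next
    case (Suc n)
    have "card (A n) - n \<le> card (C n f)" for f
    proof -
      have "card (A n) - n \<le> card (A n) - card (f ` {..<n})"
        using card_image_le[of "{..<n}" f] by simp
      also have "\<dots> \<le> card (C n f)"
        unfolding C_def by (rule diff_card_le_card_Diff) simp
      finally show ?thesis .
    qed
    then have "card (X n) * (card (A n) - n) \<le> card (X (Suc n))"
      using sum_mono[of "X n" "\<lambda>_. card (A n) - n" "\<lambda>f. card (C n f)"] by (simp add: seq)
    with Suc show ?case by (simp add: order.trans[OF mult_right_mono])
  qed
  also have "X n = {f \<in> PiE {..<n} A. inj_on f {..<n}}"
  proof (intro equalityI subsetI)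
    fix f assume f: "f \<in> X n"
    have "f i \<noteq> f j" if "j < i" "i < n" for i j
      using f that by (auto simp: X_def C_def)
    then have "inj_on f {..<n}" by (intro linorder_inj_onI) (auto simp: eq_commute)
    then show "f \<in> {f \<in> PiE {..<n} A. inj_on f {..<n}}"
      using f by (auto simp: X_def C_def PiE_def)
  next
    fix f assume f: "f \<in> {f \<in> PiE {..<n} A. inj_on f {..<n}}"
    have "f i \<notin> f ` {..<i}" if "i < n" for i
      using f that by (fastforce simp: inj_on_def)
    then show "f \<in> X n" using f by (auto simp: X_def C_def PiE_def)
  qed
  finally show ?thesis .
qed

text \<open>The first vertex is free in \<open>V\<close>, and each of the \<open>n\<close> later
  ones is chosen among the at most \<open>D\<close> neighbours of its predecessor.\<close>

lemma card_walks_le: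
  assumes "finite V" and "\<And>x. finite (N x)" and "\<And>x. x \<in> V \<Longrightarrow> card (N x) \<le> D"
    and "\<And>x. N x \<subseteq> V"
  shows "finite {f \<in> {..<Suc n} \<rightarrow>\<^sub>E V. \<forall>i<n. f (Suc i) \<in> N (f i)}" (is "finite ?W")
    and "card {f \<in> {..<Suc n} \<rightarrow>\<^sub>E V. \<forall>i<n. f (Suc i) \<in> N (f i)} \<le> card V * D ^ n"
proof -
  define C where "C = (\<lambda>(i::nat) f. if i = 0 then V else N (f (i - 1)))"
  define X where "X = (\<lambda>n. {f \<in> extensional {..<n}. \<forall>i<n. f i \<in> C i f})"
  have seq: "card (X (Suc n)) = (\<Sum>f\<in>X n. card (C n f))" for n
    unfolding X_def by (rule card_sequential_choices) (use assms in \<open>auto simp: C_def\<close>)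
  have CV: "C i f \<subseteq> V" for i f using assms(4) by (auto simp: C_def)
  have W: "X (Suc n) = {f \<in> {..<Suc n} \<rightarrow>\<^sub>E V. \<forall>i<n. f (Suc i) \<in> N (f i)}" for n
  proof (intro equalityI subsetI)
    fix f assume f: "f \<in> X (Suc n)"
    have "f (Suc i) \<in> N (f i)" if "i < n" for i
      using f that by (auto simp: X_def C_def dest: spec[of _ "Suc i"])
    moreover have "f i \<in> V" if "i < Suc n" for i
      using f that CV[of i f] by (auto simp: X_def)
    ultimately show "f \<in> {f \<in> {..<Suc n} \<rightarrow>\<^sub>E V. \<forall>i<n. f (Suc i) \<in> N (f i)}"
      using f by (simp add: X_def PiE_def)
  next
    fix f assume f: "f \<in> {f \<in> {..<Suc n} \<rightarrow>\<^sub>E V. \<forall>i<n. f (Suc i) \<in> N (f i)}"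
    have "f i \<in> C i f" if "i < Suc n" for i
      using f that by (cases i) (auto simp: C_def)
    then show "f \<in> X (Suc n)" using f by (auto simp: X_def PiE_def)
  qed
  show "finite ?W"
    using assms(1) by (intro finite_subset[OF _ finite_PiE[of "{..<Suc n}" "\<lambda>_. V"]]) auto
  have "card (X (Suc n)) \<le> card V * D ^ n"
  proof (induction n)
    case 0 then show ?case by (simp add: seq) (simp add: X_def C_def)
  next
    case (Suc n)
    have "card (C (Suc n) f) \<le> D" if "f \<in> X (Suc n)" for f
      using that assms(3) unfolding W by (auto simp: C_def PiE_def Pi_def)
    then have "card (X (Suc (Suc n))) \<le> card (X (Suc n)) * D"
      unfolding seq[of "Suc n"] by (rule sum_bounded_above[where K = D, simplified])
    also have "\<dots> \<le> card V * D ^ n * D" using Suc by (rule mult_right_mono) simp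
    finally show ?case by (simp add: mult_ac)
  qed
  then show "card {f \<in> {..<Suc n} \<rightarrow>\<^sub>E V. \<forall>i<n. f (Suc i) \<in> N (f i)} \<le> card V * D ^ n"
    by (simp add: W)
qed

section \<open>Copies as images of injective labellings\<close>

text \<open>Describes a copy of \<open>F\<close> by an injective labelling of its vertices, so that
  counting subgraphs becomes counting functions.\<close>

definition map_graph :: "('a \<Rightarrow> 'b) \<Rightarrow> 'a ugraph \<Rightarrow> 'b ugraph" where
  "map_graph f F = (f ` verts F, (\<lambda>e. f ` e) ` edges F)"

lemma graph_iso_iff_map_graph:
  "graph_iso F H \<longleftrightarrow> (\<exists>f. inj_on f (verts F) \<and> H = map_graph f F)"
  unfolding graph_iso_def map_graph_def bij_betw_def by (cases H) auto

lemma map_graph_cong: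
  assumes "\<And>e. e \<in> edges F \<Longrightarrow> e \<subseteq> verts F" and "\<And>x. x \<in> verts F \<Longrightarrow> f x = g x"
  shows "map_graph f F = map_graph g F"
  unfolding map_graph_def using assms
  by (intro arg_cong2[where f = Pair] image_cong refl) auto

lemma finite_copies:
  assumes "simple_graph G"
  shows "finite (copies F G)"
proof (rule finite_subset)
  have "finite (edges G)"
    using assms finite_subset[of "edges G" "Pow (verts G)"] by (auto simp: simple_graph_def)
  then show "finite (Pow (verts G) \<times> Pow (edges G))"
    using assms by (simp add: simple_graph_def)
qed (auto simp: copies_def subgraph_of_def)

lemma verts_cycle [simp]: "verts (cycle m) = {..<m}"
  by (simp add: cycle_def)

lemma doubleton_in_edges_cycle:
  "{u, v} \<in> edges (cycle m) \<longleftrightarrow> u < m \<and> v = (u + 1) mod m \<or> v < m \<and> u = (v + 1) mod m"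
  by (auto simp: cycle_def doubleton_eq_iff)

lemma edges_map_graph_cycle:
  "edges (map_graph f (cycle k)) = {{f i, f ((i + 1) mod k)} | i. i < k}"
  by (auto simp: map_graph_def cycle_def image_iff) (metis image_empty image_insert)

text \<open>A vertex of a cycle has only two neighbours, and injectivity rules out the one just
  left, so the first two labels determine the rest by induction. Fixing them excludes all rotations
  and reflections of the labelling.\<close>

lemma map_graph_cycle_eqD:
  assumes inj: "inj_on f {..<k}" "inj_on g {..<k}"
    and eq: "map_graph f (cycle k) = map_graph g (cycle k)"
    and start: "f 0 = g 0" "f 1 = g 1"
  shows "\<forall>i<k. f i = g i"
proof (intro allI impI)
  fix i assume "i < k"
  then show "f i = g i"
  proof (induction i rule: less_induct)
    case (less i)
    show ?case
    proof (cases "i \<le> 1")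
      case True
      then show ?thesis using start by (cases i) auto
    next
      case False
      then obtain j where j: "i = Suc (Suc j)"
        using that[of "i - 2"] by simp
      have IH: "f j = g j" "f (Suc j) = g (Suc j)" using less j by auto
      have "{f (Suc j), f i} \<in> edges (map_graph f (cycle k))"
        unfolding edges_map_graph_cycle using less.prems j
        by (intro CollectI exI[of _ "Suc j"]) auto
      then obtain a where a: "a < k" "{f (Suc j), f i} = {g a, g ((a + 1) mod k)}"
        unfolding eq edges_map_graph_cycle by auto
      have g_inj: "g x = g y \<Longrightarrow> x < k \<Longrightarrow> y < k \<Longrightarrow> x = y" for x y
        using inj(2) by (auto simp: inj_on_def)
      from a(2) consider "f (Suc j) = g a" "f i = g ((a + 1) mod k)"
        | "f (Suc j) = g ((a + 1) mod k)" "f i = g a"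
        by (auto simp: doubleton_eq_iff)
      then show ?thesis
      proof cases
        case 1
        then have "a = Suc j" using IH g_inj[of "Suc j" a] a(1) less.prems j by simp
        then show ?thesis using 1 less.prems j by simp
      next
        \<comment> \<open>Matched in the reverse direction, the edge is the one between positions
          \<open>j\<close> and \<open>Suc j\<close>, so \<open>f i\<close> would repeat
          \<open>f j\<close>.\<close>
        case 2
        then have "(a + 1) mod k = Suc j"
          using IH g_inj[of "Suc j" "(a + 1) mod k"] less.prems j by simp
        then have "a = j" using a(1) by (cases "a + 1 = k") auto
        then have "f i = f j" using 2 IH by simp
        then have "i = j" using inj(1) less.prems j by (auto simp: inj_on_def)
        then show ?thesis using j by simp
      qed
    qed
  qed
qed

section \<open>Upper bound for cycles from the maximum degree\<close>

text \<open>Every copy is the image of a walk on \<open>k\<close> vertices. The bound forgets the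
  closing edge and injectivity and does not divide by the number of labellings; this is affordable
  since only the exponential rate in \<open>k\<close> matters later.\<close>

lemma num_copies_cycle_le:
  assumes "simple_graph G" and k: "k \<ge> 1"
    and deg: "\<And>x. x \<in> verts G \<Longrightarrow> card {y. {x, y} \<in> edges G} \<le> D"
  shows "num_copies (cycle k) G \<le> card (verts G) * D ^ (k - 1)"
proof -
  let ?V = "verts G" and ?N = "\<lambda>x. {y. {x, y} \<in> edges G}"
  let ?W = "{f \<in> {..<Suc (k - 1)} \<rightarrow>\<^sub>E ?V. \<forall>i<k - 1. f (Suc i) \<in> ?N (f i)}"
  have V: "finite ?V" and NV: "?N x \<subseteq> ?V" for x
    using assms(1) by (auto simp: simple_graph_def)
  note W = card_walks_le[where N = ?N, OF V finite_subset[OF NV V] deg NV, where n = "k - 1"]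
  have "copies (cycle k) G \<subseteq> (\<lambda>f. map_graph f (cycle k)) ` ?W"
  proof
    fix H assume "H \<in> copies (cycle k) G"
    then obtain f where f: "H = map_graph f (cycle k)" "subgraph_of H G"
      by (auto simp: copies_def graph_iso_iff_map_graph)
    \<comment> \<open>The walks in \<open>?W\<close> are extensional, so the labelling has to be cut
      off outside \<open>{..<k}\<close>.\<close>
    let ?f = "restrict f {..<k}"
    have "H = map_graph ?f (cycle k)"
      unfolding f(1) by (rule map_graph_cong) (use k in \<open>auto simp: cycle_def\<close>)
    moreover have "?f \<in> ?W"
    proof -
      have "f i \<in> ?V" if "i < k" for i
        using f that by (auto simp: subgraph_of_def map_graph_def)
      moreover have "{f i, f (Suc i)} \<in> edges G" if "Suc i < k" for i
      proof -
        have "{f i, f (Suc i)} \<in> edges H"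
          unfolding f(1) edges_map_graph_cycle using that by (intro CollectI exI[of _ i]) auto
        then show ?thesis using f(2) by (auto simp: subgraph_of_def)
      qed
      ultimately show ?thesis using k by auto
    qed
    ultimately show "H \<in> (\<lambda>f. map_graph f (cycle k)) ` ?W" by blast
  qed
  then have "card (copies (cycle k) G) \<le> card ((\<lambda>f. map_graph f (cycle k)) ` ?W)"
    using W(1) by (intro card_mono) auto
  also have "\<dots> \<le> card ?W" using W(1) by (rule card_image_le)
  also note W(2)
  finally show ?thesis by (simp add: num_copies_def)
qed

lemma card_cycle_neighbours_le: "card {v. {u, v} \<in> edges (cycle m)} \<le> 2"
proof -
  \<comment> \<open>The predecessor is written with \<open>u + m - 1\<close> because
    \<open>u - 1\<close> would truncate at \<open>u = 0\<close>.\<close>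
  have "{v. {u, v} \<in> edges (cycle m)} \<subseteq> {(u + 1) mod m, (u + m - 1) mod m}"
  proof
    fix v assume "v \<in> {v. {u, v} \<in> edges (cycle m)}"
    then consider "v = (u + 1) mod m" | "v < m" "u = (v + 1) mod m"
      by (auto simp: doubleton_in_edges_cycle)
    then show "v \<in> {(u + 1) mod m, (u + m - 1) mod m}"
    proof cases
      case 2
      then have "(u + m - 1) mod m = v"
        by (cases "v + 1 = m") auto
      then show ?thesis by simp
    qed simp
  qed
  then have "card {v. {u, v} \<in> edges (cycle m)} \<le> card {(u + 1) mod m, (u + m - 1) mod m}"
    by (intro card_mono) auto
  also have "\<dots> \<le> 2" by (rule card_insert_le_m1) auto
  finally show ?thesis .
qed

text \<open>A neighbour of \<open>x\<close> lies in one of at most two parts, and balance bounds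
  each part by the average size plus one.\<close>

lemma degree_balanced_blowup_cycle_le:
  assumes "balanced_blowup (cycle m) B" and m: "m > 0"
  shows "card {y. {x, y} \<in> edges B} \<le> 2 * (card (verts B) div m + 1)"
proof -
  obtain p where V: "finite (verts B)" and p: "p \<in> verts B \<rightarrow> {..<m}"
    and E: "edges B = {{x, y} | x y. x \<in> verts B \<and> y \<in> verts B \<and> {p x, p y} \<in> edges (cycle m)}"
    and bal: "\<And>u v. u < m \<Longrightarrow> v < m \<Longrightarrow>
        card {x \<in> verts B. p x = u} \<le> card {x \<in> verts B. p x = v} + 1"
    using assms unfolding balanced_blowup_def simple_graph_def by auto
  let ?P = "\<lambda>u. {x \<in> verts B. p x = u}" and ?N = "{v. {p x, v} \<in> edges (cycle m)}"
  have part: "card (?P u) \<le> card (verts B) div m + 1" if u: "u < m" for u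
  proof -
    \<comment> \<open>By balance all \<open>m\<close> parts have at least
      \<open>card (?P u) - 1\<close> vertices; summing this over the parts bounds it by the
      average.\<close>
    have "m * (card (?P u) - 1) = (\<Sum>v<m. card (?P u) - 1)" by simp
    also have "\<dots> \<le> (\<Sum>v<m. card (?P v))"
      using bal[OF u] by (intro sum_mono) (simp add: le_diff_conv)
    also have "\<dots> = card (verts B)"
      using V p by (subst card_eq_sum, subst sum.group[symmetric, where g = p and T = "{..<m}"]) auto
    finally have "card (?P u) - 1 \<le> card (verts B) div m"
      using m by (simp add: less_eq_div_iff_mult_less_eq mult.commute)
    then show ?thesis by simp
  qed
  have N: "finite ?N" "?N \<subseteq> {..<m}"
    using m by (auto simp: doubleton_in_edges_cycle intro: finite_subset[of _ "{..<m}"])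
  have "{y. {x, y} \<in> edges B} \<subseteq> (\<Union>v\<in>?N. ?P v)"
    by (auto simp: E doubleton_eq_iff insert_commute)
  then have "card {y. {x, y} \<in> edges B} \<le> card (\<Union>v\<in>?N. ?P v)"
    using V N by (intro card_mono) auto
  also have "\<dots> \<le> (\<Sum>v\<in>?N. card (?P v))" by (rule card_UN_le[OF N(1)])
  also have "\<dots> \<le> card ?N * (card (verts B) div m + 1)"
    using N part sum_bounded_above[of ?N "\<lambda>v. card (?P v)" "card (verts B) div m + 1"]
    by auto
  also have "\<dots> \<le> 2 * (card (verts B) div m + 1)"
    using card_cycle_neighbours_le by (rule mult_right_mono) simp
  finally show ?thesis .
qed

section \<open>Blow-ups: absence of short odd cycles, and many copies along a closed walk\<close>

text \<open>The edges are formed as in \<open>balanced_blowup\<close>, but the part sizes are left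
  to \<open>p\<close>, so that unbalanced blow-ups are covered.\<close>

definition blowup :: "'a ugraph \<Rightarrow> 'b set \<Rightarrow> ('b \<Rightarrow> 'a) \<Rightarrow> 'b ugraph" where
  "blowup F V p = (V, {{x, y} | x y. x \<in> V \<and> y \<in> V \<and> {p x, p y} \<in> edges F})"

lemma simple_graph_blowup:
  assumes "simple_graph F" and "finite V"
  shows "simple_graph (blowup F V p)"
proof -
  have "{u} \<notin> edges F" for u using assms(1) by (auto simp: simple_graph_def)
  then show ?thesis
    using assms(2) by (auto simp: simple_graph_def blowup_def card_2_iff) (metis insert_absorb2)
qed

lemma doubleton_in_edges_blowup:
  "{x, y} \<in> edges (blowup F V p) \<longleftrightarrow> x \<in> V \<and> y \<in> V \<and> {p x, p y} \<in> edges F"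
  by (auto simp: blowup_def doubleton_eq_iff insert_commute)

text \<open>Write a closed walk of length \<open>l\<close> in the cycle as \<open>l\<close> steps \<open>\<plusminus>1\<close>. Their sum is odd, is
  divisible by \<open>m\<close>, and has absolute value at most \<open>l < m\<close>.\<close>

lemma no_short_odd_closed_walk_in_cycle:
  assumes "odd l" and "l < m"
    and walk: "\<And>i. i < l \<Longrightarrow> {g i, g ((i + 1) mod l)} \<in> edges (cycle m)"
  shows False
proof -
  \<comment> \<open>Vertices of the cycle are residues, so the sign of a step is recovered only up
    to a multiple of \<open>m\<close>.\<close>
  have "\<exists>e::int. (e = 1 \<or> e = - 1) \<and> int m dvd int (g ((i + 1) mod l)) - int (g i) - e"
    if "i < l" for i
  proof -
    from walk[OF that] consider "g ((i + 1) mod l) = (g i + 1) mod m"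
      | "g i = (g ((i + 1) mod l) + 1) mod m"
      by (auto simp: doubleton_in_edges_cycle)
    then show ?thesis
    proof cases
      case 1
      then have "int (g ((i + 1) mod l)) = (int (g i) + 1) mod int m" by (simp add: zmod_int add.commute)
      then have "int m dvd int (g ((i + 1) mod l)) - (int (g i) + 1)"
        by (metis mod_eq_dvd_iff mod_mod_trivial)
      then show ?thesis by (intro exI[of _ 1]) (simp add: algebra_simps)
    next
      case 2
      then have "int (g i) = (int (g ((i + 1) mod l)) + 1) mod int m" by (simp add: zmod_int add.commute)
      then have "int m dvd (int (g ((i + 1) mod l)) + 1) - int (g i)"
        by (metis mod_eq_dvd_iff mod_mod_trivial)
      then show ?thesis by (intro exI[of _ "-1"]) (simp add: algebra_simps)
    qed
  qed
  then obtain e :: "nat \<Rightarrow> int" where e: "\<And>i. i < l \<Longrightarrow> e i = 1 \<or> e i = - 1"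
    and dvd: "\<And>i. i < l \<Longrightarrow> int m dvd int (g ((i + 1) mod l)) - int (g i) - e i"
    by metis
  have l: "l > 0" using assms(1) by (cases l) auto
  \<comment> \<open>The cyclic shift permutes the indices, so the differences along the closed walk
    sum to zero and only the signs remain.\<close>
  have "bij_betw (\<lambda>i. (i + 1) mod l) {..<l} {..<l}"
  proof -
    have "inj_on (\<lambda>i. (i + 1) mod l) {..<l}"
    proof (rule inj_onI)
      fix x y assume "x \<in> {..<l}" "y \<in> {..<l}" "(x + 1) mod l = (y + 1) mod l"
      then show "x = y" by (cases "x + 1 = l"; cases "y + 1 = l") auto
    qed
    moreover have "(\<lambda>i. (i + 1) mod l) ` {..<l} \<subseteq> {..<l}" using l by auto
    ultimately show ?thesis by (simp add: bij_betw_def endo_inj_surj)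
  qed
  then have "(\<Sum>i<l. int (g ((i + 1) mod l))) = (\<Sum>i<l. int (g i))"
    by (rule sum.reindex_bij_betw)
  moreover have "int m dvd (\<Sum>i<l. int (g ((i + 1) mod l)) - int (g i) - e i)"
    using dvd by (intro dvd_sum) auto
  ultimately have "int m dvd (\<Sum>i<l. e i)" by (simp add: sum_subtractf)
  moreover have "\<bar>\<Sum>i<l. e i\<bar> \<le> int l"
  proof -
    have "\<bar>\<Sum>i<l. e i\<bar> \<le> (\<Sum>i<l. \<bar>e i\<bar>)" by (rule sum_abs)
    also have "\<dots> = (\<Sum>i<l. 1)" using e by (intro sum.cong refl) fastforce
    finally show ?thesis by simp
  qed
  ultimately have "(\<Sum>i<l. e i) = 0"
    using assms(2) zdvd_imp_le[of "int m" "\<bar>\<Sum>i<l. e i\<bar>"] by fastforce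
  moreover have "even (\<Sum>i<l. e i - 1)"
    using e by (intro dvd_sum) fastforce
  ultimately show False using assms(1) by (simp add: sum_subtractf)
qed

text \<open>Composing a labelling of a copy with \<open>p\<close> would give a closed walk of odd
  length \<open>l < m\<close> in the cycle of length \<open>m\<close>.\<close>

lemma graph_free_blowup_cycle:
  assumes "odd l" and "l < m"
  shows "graph_free (cycle l) (blowup (cycle m) V p)"
proof -
  have False if H: "H \<in> copies (cycle l) (blowup (cycle m) V p)" for H
  proof -
    obtain f where f: "H = map_graph f (cycle l)"
      and sub: "edges H \<subseteq> edges (blowup (cycle m) V p)"
      using H by (auto simp: copies_def graph_iso_iff_map_graph subgraph_of_def)
    have "{p (f i), p (f ((i + 1) mod l))} \<in> edges (cycle m)" if "i < l" for i
    proof -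
      have "{f i, f ((i + 1) mod l)} \<in> edges (blowup (cycle m) V p)"
        using sub that unfolding f edges_map_graph_cycle by blast
      then show ?thesis by (simp only: doubleton_in_edges_blowup)
    qed
    with no_short_odd_closed_walk_in_cycle[OF assms, of "\<lambda>i. p (f i)"] show False by blast
  qed
  then show ?thesis by (auto simp: graph_free_def)
qed

text \<open>Only copies following one fixed closed walk \<open>q\<close> are counted. As \<open>q\<close> visits the first two
  of its vertices only once, such a copy determines where its labelling starts and in which
  direction it proceeds, so that no symmetry has to be divided out.\<close>

lemma num_copies_cycle_blowup_ge:
  assumes "k \<ge> 3" and F: "simple_graph F" and "finite V"
    and walk: "\<And>i. i < k \<Longrightarrow> {q i, q ((i + 1) mod k)} \<in> edges F"
    and once: "\<And>i. i < k \<Longrightarrow> q i = q 0 \<Longrightarrow> i = 0" "\<And>i. i < k \<Longrightarrow> q i = q 1 \<Longrightarrow> i = 1"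
  shows "(\<Prod>i<k. card {x \<in> V. p x = q i} - i) \<le> num_copies (cycle k) (blowup F V p)"
proof -
  let ?S = "{f \<in> PiE {..<k} (\<lambda>i. {x \<in> V. p x = q i}). inj_on f {..<k}}"
  let ?h = "\<lambda>f. map_graph f (cycle k)"
  have "inj_on ?h ?S"
  proof (rule inj_onI)
    fix f g assume f: "f \<in> ?S" and g: "g \<in> ?S" and eq: "?h f = ?h g"
    have pf: "p (f i) = q i" and pg: "p (g i) = q i" if "i < k" for i
      using f g that by (auto simp: PiE_def Pi_def)
    have img: "f ` {..<k} = g ` {..<k}" using eq by (simp add: map_graph_def)
    \<comment> \<open>Both labellings have the same image, so \<open>f j = g i\<close> for some
      \<open>i\<close>. Applying \<open>p\<close> gives \<open>q i = q j\<close>, and a value that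
      \<open>q\<close> takes only once forces \<open>i = j\<close>.\<close>
    have start: "f j = g j" if j: "j < k" "\<And>i. i < k \<Longrightarrow> q i = q j \<Longrightarrow> i = j" for j
    proof -
      have "f j \<in> g ` {..<k}" using img j(1) by blast
      then obtain i where "i < k" "f j = g i" by auto
      with pf[OF j(1)] pg[of i] j(2)[of i] show ?thesis by auto
    qed
    have "\<forall>i<k. f i = g i"
      using f g eq assms(1) start[of 0] start[of 1] once
      by (intro map_graph_cycle_eqD) auto
    then show "f = g" using f g by (intro PiE_ext[of f "{..<k}" "\<lambda>i. {x \<in> V. p x = q i}" g]) auto
  qed
  moreover have "?h ` ?S \<subseteq> copies (cycle k) (blowup F V p)"
  proof (rule image_subsetI)
    fix f assume "f \<in> ?S"
    then have f: "f \<in> PiE {..<k} (\<lambda>i. {x \<in> V. p x = q i})" and inj: "inj_on f {..<k}" by auto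
    have fi: "f i \<in> V" "p (f i) = q i" if "i < k" for i
      using f that by (auto simp: PiE_def Pi_def)
    have "{f i, f ((i + 1) mod k)} \<in> edges (blowup F V p)" if "i < k" for i
      using that walk[OF that] fi[OF that] fi[of "(i + 1) mod k"]
      by (simp only: doubleton_in_edges_blowup) simp
    then have "edges (?h f) \<subseteq> edges (blowup F V p)"
      unfolding edges_map_graph_cycle by blast
    moreover have "verts (?h f) \<subseteq> verts (blowup F V p)"
      using fi by (auto simp: map_graph_def blowup_def)
    moreover have "simple_graph (?h f)"
      using simple_graph_cycle[OF assms(1)] inj
      by (auto simp: simple_graph_def map_graph_def card_image inj_on_subset)
    ultimately show "?h f \<in> copies (cycle k) (blowup F V p)"
      using inj by (auto simp: copies_def subgraph_of_def graph_iso_iff_map_graph)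
  qed
  ultimately have "card ?S \<le> num_copies (cycle k) (blowup F V p)"
    unfolding num_copies_def
    using finite_copies[OF simple_graph_blowup[OF F \<open>finite V\<close>]] by (rule card_inj_on_le)
  moreover have "(\<Prod>i<k. card {x \<in> V. p x = q i} - i) \<le> card ?S"
    using \<open>finite V\<close> by (intro card_inj_PiE_ge) auto
  ultimately show ?thesis by linarith
qed

section \<open>The skewed blow-up and its cycles\<close>

text \<open>Each of the \<open>n div N\<close> full blocks of \<open>N\<close> consecutive integers
  below \<open>n\<close> contains every residue of \<open>R\<close> once.\<close>

lemma card_mod_mem_ge:
  fixes N :: nat
  assumes R: "R \<subseteq> {..<N}"
  shows "card R * (n div N) \<le> card {x \<in> {..<n}. x mod N \<in> R}"
proof -
  let ?h = "\<lambda>(r, q). q * N + r"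
  have h: "?h (r, q) < n" "?h (r, q) mod N = r" "?h (r, q) div N = q"
    if "r \<in> R" "q < n div N" for r q
  proof -
    have "r < N" using R that by auto
    then have "q * N + r < Suc q * N" by simp
    also have "\<dots> \<le> n div N * N" using that by (intro mult_right_mono) auto
    also have "\<dots> \<le> n" by simp
    finally show "?h (r, q) < n" by simp
    show "?h (r, q) mod N = r" "?h (r, q) div N = q" using \<open>r < N\<close> by auto
  qed
  have "inj_on ?h (R \<times> {..<n div N})"
  proof (rule inj_onI, clarify)
    fix r q r' q'
    assume "r \<in> R" "q < n div N" "r' \<in> R" "q' < n div N" "q * N + r = q' * N + r'"
    then show "r = r' \<and> q = q'" using h[of r q] h[of r' q'] by auto
  qed
  moreover have "?h ` (R \<times> {..<n div N}) \<subseteq> {x \<in> {..<n}. x mod N \<in> R}"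
    using h by auto
  ultimately have "card (R \<times> {..<n div N}) \<le> card {x \<in> {..<n}. x mod N \<in> R}"
    by (rule card_inj_on_le) simp
  then show ?thesis by (simp add: card_cartesian_product)
qed

text \<open>Periodicity realises the densities exactly on each block of length
  \<open>20 * l\<close>: the adjacent parts 0 and 1 receive \<open>9 * l\<close> residues each, and
  the remaining \<open>2 * l\<close> residues give two to each of the parts 2 to
  \<open>l + 1\<close>.\<close>

definition skew_part :: "nat \<Rightarrow> nat \<Rightarrow> nat" where
  "skew_part l x = (let y = x mod (20 * l) in
     if y < 9 * l then 0 else if y < 18 * l then 1 else 2 + (y - 18 * l) mod l)"

lemma card_skew_part_ge:
  assumes l: "l > 0"
  shows "u < 2 \<Longrightarrow> 9 * l * (n div (20 * l)) \<le> card {x \<in> {..<n}. skew_part l x = u}"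
    and "i < l \<Longrightarrow> 2 * (n div (20 * l)) \<le> card {x \<in> {..<n}. skew_part l x = i + 2}"
proof -
  have gen: "card R * (n div (20 * l)) \<le> card {x \<in> {..<n}. skew_part l x = u}"
    if "R \<subseteq> {..<20 * l}" and R: "\<And>x. x mod (20 * l) \<in> R \<Longrightarrow> skew_part l x = u" for R u
  proof -
    have "card R * (n div (20 * l)) \<le> card {x \<in> {..<n}. x mod (20 * l) \<in> R}"
      using that(1) by (rule card_mod_mem_ge)
    also have "\<dots> \<le> card {x \<in> {..<n}. skew_part l x = u}"
      using R by (intro card_mono) auto
    finally show ?thesis .
  qed
  show "9 * l * (n div (20 * l)) \<le> card {x \<in> {..<n}. skew_part l x = u}" if "u < 2"
  proof -
    have "{9 * l * u..<9 * l * u + 9 * l} \<subseteq> {..<20 * l}"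
      using that by (auto simp: less_2_cases_iff)
    moreover have "skew_part l x = u" if "x mod (20 * l) \<in> {9 * l * u..<9 * l * u + 9 * l}" for x
      using that \<open>u < 2\<close> by (auto simp: skew_part_def Let_def less_2_cases_iff)
    ultimately show ?thesis using gen[of "{9 * l * u..<9 * l * u + 9 * l}" u] by simp
  qed
  show "2 * (n div (20 * l)) \<le> card {x \<in> {..<n}. skew_part l x = i + 2}" if "i < l"
  proof -
    have "skew_part l x = i + 2" if "x mod (20 * l) \<in> {18 * l + i, 19 * l + i}" for x
      using that \<open>i < l\<close> by (auto simp: skew_part_def Let_def)
    then show ?thesis using gen[of "{18 * l + i, 19 * l + i}" "i + 2"] l that by simp
  qed
qed

text \<open>The walk spends \<open>l\<close> steps in the small parts and \<open>k - l\<close> in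
  the two large ones. Subtracting \<open>k\<close> instead of the index makes all factors of one
  kind equal.\<close>

lemma num_copies_cycle_skew_blowup_ge:
  assumes "odd l" "l \<ge> 3" and "odd k" "k > l"
  shows "(2 * (n div (20 * l)) - k) ^ l * (9 * l * (n div (20 * l)) - k) ^ (k - l)
    \<le> num_copies (cycle k) (blowup (cycle (l + 2)) {..<n} (skew_part l))"
proof -
  \<comment> \<open>The walk visits 2, 3, ..., \<open>l + 1\<close> and then alternates 0, 1, 0, 1.
    As \<open>k - l\<close> is even it ends at 1, which is adjacent to its start 2. Starting among
    the small parts makes the first two vertices occur only once.\<close>
  define q where "q = (\<lambda>i. if i < l then i + 2 else (i - l) mod 2)"
  let ?t = "n div (20 * l)"
  have walk: "{q i, q ((i + 1) mod k)} \<in> edges (cycle (l + 2))" if i: "i < k" for i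
  proof -
    consider "i + 1 < l" | "i + 1 = l" | "l \<le> i" "i + 1 < k" | "i + 1 = k" using i by linarith
    then show ?thesis
    proof cases
      case 1
      then show ?thesis using assms by (auto simp: q_def doubleton_in_edges_cycle)
    next
      case 2
      then show ?thesis using assms by (auto simp: q_def doubleton_in_edges_cycle)
    next
      case 3
      then have "q i = 0 \<and> q (i + 1) = 1 \<or> q i = 1 \<and> q (i + 1) = 0"
        by (auto simp: q_def Suc_diff_le mod_Suc)
      then show ?thesis using 3 by (auto simp: doubleton_in_edges_cycle)
    next
      case 4
      then have "odd (i - l)" "l \<le> i" using assms by auto
      then have "q i = 1"
        unfolding q_def by (simp only: not_less[symmetric] odd_iff_mod_2_eq_one if_False)
      moreover have "q 0 = 2" using assms by (simp add: q_def)
      ultimately show ?thesis using 4 assms by (auto simp: doubleton_in_edges_cycle)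
    qed
  qed
  have once: "q i = q 0 \<Longrightarrow> i = 0" "q i = q 1 \<Longrightarrow> i = 1" for i
  proof -
    have "q i < 2" if "\<not> i < l" using that by (simp add: q_def)
    moreover have "q 0 = 2" "q 1 = 3" "i < l \<Longrightarrow> q i = i + 2" using assms by (auto simp: q_def)
    ultimately show "q i = q 0 \<Longrightarrow> i = 0" "q i = q 1 \<Longrightarrow> i = 1" by (cases "i < l"; simp)+
  qed
  let ?c = "\<lambda>i. card {x \<in> {..<n}. skew_part l x = q i} - i"
  have "(2 * ?t - k) ^ l * (9 * l * ?t - k) ^ (k - l)
      = (\<Prod>i<l. 2 * ?t - k) * (\<Prod>i\<in>{l..<k}. 9 * l * ?t - k)" by simp
  also have "\<dots> \<le> (\<Prod>i<l. ?c i) * (\<Prod>i\<in>{l..<k}. ?c i)"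
  proof (intro mult_mono prod_mono conjI)
    fix i assume "i \<in> {..<l}"
    then have i: "i < l" "q i = i + 2" by (auto simp: q_def)
    then have "2 * ?t \<le> card {x \<in> {..<n}. skew_part l x = q i}"
      using card_skew_part_ge(2)[of l i n] by simp
    then show "2 * ?t - k \<le> ?c i" by (rule diff_le_mono[THEN order.trans]) (use i assms in simp)
  next
    fix i assume "i \<in> {l..<k}"
    then have i: "i < k" "q i < 2" by (auto simp: q_def)
    then have "9 * l * ?t \<le> card {x \<in> {..<n}. skew_part l x = q i}"
      using card_skew_part_ge(1)[of l "q i" n] assms by simp
    then show "9 * l * ?t - k \<le> ?c i" by (rule diff_le_mono[THEN order.trans]) (use i in simp)
  qed auto
  also have "\<dots> = (\<Prod>i<k. ?c i)"
    using assms(4) by (subst prod.union_disjoint[symmetric]) (auto intro!: prod.cong)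
  also have "\<dots> \<le> num_copies (cycle k) (blowup (cycle (l + 2)) {..<n} (skew_part l))"
    using assms walk once by (intro num_copies_cycle_blowup_ge simple_graph_cycle) auto
  finally show ?thesis .
qed

section \<open>Comparison of the two counts\<close>

lemma exponential_gap:
  fixes a b c d :: real
  assumes "0 < b" "b < a" "c > 0"
  shows "\<exists>k0. \<forall>k\<ge>k0. d * b ^ k < c * a ^ k"
proof -
  have ab: "1 < a / b" using assms by simp
  then obtain K where K: "d / c < (a / b) ^ K" using real_arch_pow by blast
  have "d * b ^ k < c * a ^ k" if "k \<ge> K" for k
  proof -
    have "(a / b) ^ K \<le> (a / b) ^ k" using that ab by (intro power_increasing) auto
    with K have "d / c < a ^ k / b ^ k" by (simp add: power_divide)
    then show ?thesis using assms by (simp add: field_simps)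
  qed
  then show ?thesis by blast
qed

theorem theorem1p2:
  fixes l :: nat
  assumes "odd l" and "l \<ge> 3"
  shows "\<exists>k0 :: nat. \<forall>k \<ge> k0. odd k \<longrightarrow>
    (\<exists>G :: nat \<Rightarrow> nat ugraph.
      (\<forall>n. simple_graph (G n) \<and> card (verts (G n)) = n \<and> graph_free (cycle l) (G n)) \<and>
      (\<exists>c :: real. c > 0 \<and>
        (\<forall>\<^sub>F n in sequentially. \<forall>B :: nat ugraph.
          card (verts B) = n \<and> balanced_blowup (cycle (l + 2)) B \<longrightarrow>
          real (num_copies (cycle k) (G n)) \<ge> real (num_copies (cycle k) B) + c * real n ^ k)))"
proof -
  \<comment> \<open>Half the limiting density \<open>1 / (10 * l)\<close> of a small part; the other
    half absorbs rounding and the subtracted \<open>k\<close>.\<close>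
  define \<alpha> :: real where "\<alpha> = 1 / (20 * real l)"
  have \<alpha>: "\<alpha> > 0" using assms by (simp add: \<alpha>_def)
  \<comment> \<open>The rates satisfy 2/5 < 21/50 < 11/25 < 9/20, leaving room for lower-order terms
    on both sides. The factors \<open>50 / 21\<close> and \<open>1 / (11 / 25) ^ l\<close> turn the
    exponents \<open>k - 1\<close> and \<open>k - l\<close> into \<open>k\<close>.\<close>
  obtain k0 where k0: "\<And>k. k \<ge> k0 \<Longrightarrow>
      50 / 21 * (21 / 50) ^ k < \<alpha> ^ l / (11 / 25) ^ l * (11 / 25 :: real) ^ k"
    using exponential_gap[of "21 / 50" "11 / 25" "\<alpha> ^ l / (11 / 25) ^ l" "50 / 21"] \<alpha> by auto
  define G where "G = (\<lambda>n. blowup (cycle (l + 2)) {..<n} (skew_part l))"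
  have G: "simple_graph (G n) \<and> card (verts (G n)) = n \<and> graph_free (cycle l) (G n)" for n
    unfolding G_def using assms
    by (intro conjI simple_graph_blowup simple_graph_cycle graph_free_blowup_cycle)
      (auto simp: blowup_def)
  have "\<exists>c :: real. c > 0 \<and>
      (\<forall>\<^sub>F n in sequentially. \<forall>B :: nat ugraph.
        card (verts B) = n \<and> balanced_blowup (cycle (l + 2)) B \<longrightarrow>
        real (num_copies (cycle k) (G n)) \<ge> real (num_copies (cycle k) B) + c * real n ^ k)"
    if k: "k \<ge> max k0 (l + 1)" "odd k" for k
  proof -
    have kl: "k > l" using k by simp
    \<comment> \<open>The difference of the two coefficients of \<open>n ^ k\<close>, positive by
      the choice of \<open>k0\<close>.\<close>
    define c :: real where "c = \<alpha> ^ l * (11 / 25) ^ (k - l) - (21 / 50) ^ (k - 1)"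
    have "c > 0"
    proof -
      have "(21 / 50 :: real) ^ (k - 1) = 50 / 21 * (21 / 50) ^ k"
        using kl by (cases k) auto
      also have "\<dots> < \<alpha> ^ l / (11 / 25) ^ l * (11 / 25) ^ k" using k by (intro k0) simp
      also have "\<dots> = \<alpha> ^ l * (11 / 25) ^ (k - l)" using kl by (simp add: power_diff)
      finally show ?thesis by (simp add: c_def)
    qed
    moreover have
      "real (num_copies (cycle k) (G n)) \<ge> real (num_copies (cycle k) B) + c * real n ^ k"
      \<comment> \<open>The three summands serve \<open>small\<close>, \<open>large\<close> and
        \<open>deg\<close> respectively.\<close>
      if n: "n \<ge> 20 * l * (2 + k) + 100 * (9 * l + k) + 100"
        and B: "card (verts B) = n" "balanced_blowup (cycle (l + 2)) B"
      for n and B :: "nat ugraph"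
    proof -
      define t where "t = n div (20 * l)"
      have "n < Suc t * (20 * l)"
        using assms dividend_less_div_times[of "20 * l" n] by (simp add: t_def)
      then have "real n < real (Suc t * (20 * l))" by (simp only: of_nat_less_iff)
      then have nt: "real n < 20 * (real l * real t) + 20 * real l" by (simp add: algebra_simps)
      have small: "\<alpha> * real n \<le> real (2 * t - k)"
      proof -
        have "real (20 * l * (2 + k)) \<le> real n" using n by (simp only: of_nat_le_iff)
        then have "2 + real k \<le> \<alpha> * real n" using assms by (simp add: \<alpha>_def field_simps)
        moreover have "\<alpha> * real n < real t + 1" using nt assms by (simp add: \<alpha>_def field_simps)
        ultimately show ?thesis by linarith
      qed
      have large: "11 / 25 * real n \<le> real (9 * l * t - k)"
      proof -
        have "real (100 * (9 * l + k)) \<le> real n" using n by (simp only: of_nat_le_iff)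
        then have "900 * real l + 100 * real k \<le> real n" by simp
        then have "11 / 25 * real n \<le> 9 * (real l * real t) - real k" using nt by linarith
        also have "\<dots> = real (9 * l * t) - real k" by simp
        also have "\<dots> \<le> real (9 * l * t - k)" by linarith
        finally show ?thesis .
      qed
      define d where "d = n div (l + 2)"
      have deg: "real (2 * (d + 1)) \<le> 21 / 50 * real n"
      proof -
        have "d * 5 \<le> d * (l + 2)" using assms by (intro mult_left_mono) auto
        also have "\<dots> \<le> n" unfolding d_def by (rule div_times_less_eq_dividend)
        finally show ?thesis using n by simp
      qed
      have "num_copies (cycle k) B \<le> n * (2 * (d + 1)) ^ (k - 1)"
        unfolding d_def using num_copies_cycle_le[of B k "2 * (n div (l + 2) + 1)"]
          degree_balanced_blowup_cycle_le[OF B(2)] B kl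
        by (simp add: balanced_blowup_def)
      then have "real (num_copies (cycle k) B) \<le> real (n * (2 * (d + 1)) ^ (k - 1))"
        by (simp only: of_nat_le_iff)
      also have "\<dots> = real n * real (2 * (d + 1)) ^ (k - 1)"
        by (simp only: of_nat_mult of_nat_power)
      also have "\<dots> \<le> real n * (21 / 50 * real n) ^ (k - 1)"
        using deg by (intro mult_left_mono power_mono) auto
      also have "\<dots> = (21 / 50) ^ (k - 1) * real n ^ k"
        using kl unfolding power_mult_distrib by (cases k) auto
      finally have upper: "real (num_copies (cycle k) B) \<le> (21 / 50) ^ (k - 1) * real n ^ k" .
      have "real n ^ k = real n ^ l * real n ^ (k - l)"
        using kl by (simp flip: power_add)
      then have "\<alpha> ^ l * (11 / 25) ^ (k - l) * real n ^ k
          = (\<alpha> * real n) ^ l * (11 / 25 * real n) ^ (k - l)"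
        unfolding power_mult_distrib by simp
      also have "\<dots> \<le> real (2 * t - k) ^ l * real (9 * l * t - k) ^ (k - l)"
        using small large \<alpha> by (intro mult_mono power_mono) auto
      also have "\<dots> = real ((2 * t - k) ^ l * (9 * l * t - k) ^ (k - l))"
        by (simp only: of_nat_mult of_nat_power)
      also have "\<dots> \<le> real (num_copies (cycle k) (G n))"
        unfolding G_def t_def of_nat_le_iff
        by (rule num_copies_cycle_skew_blowup_ge[OF assms k(2) kl])
      finally show ?thesis using upper by (simp add: c_def algebra_simps)
    qed
    ultimately show ?thesis unfolding eventually_sequentially by blast
  qed
  with G show ?thesis by blast
qed

end
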